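(* Let $\mathcal{A}$ be a unital Banach algebra, let $a,c\in\mathcal{A}$, and let $k$ be a non-negative integer. Then (i) $1-ac$ is left (resp. right) Drazin invertible with index $k$ if and only if $1-ca$ is left (resp. right) Drazin invertible with index $k$. (ii) $1-ac$ is left (resp. right) group invertible if and only if $1-ca$ is left (resp. right) group invertible. (iii) $1-ac$ is left (resp. right) generalized Drazin invertible if and only if $1-ca$ is left (resp. right) generalized Drazin invertible.
   Context: $\mathcal{A}$ is a complex unital Banach algebra, $r(\cdot)$ denotes the spectral radius, and $\mathcal{A}^{qnil}=\{a\in\mathcal{A}: r(a)=0\}$. Let $a\in\mathcal{A}$. - $a$ is left Drazin invertible with index $j$ (a non-negative integer) if there is $x\in\mathcal{A}$ with $axa=xa^2$, $x^2a=x$, $xa^{j+1}=a^j$; it is right Drazin invertible with index $j$ if there is $y\in\mathcal{A}$ with $aya=a^2y$, $ay^2=y$, $a^{j+1}y=a^j$. - $a$ is left (resp. right) group invertible if it is left (resp. right) Drazin invertible with index $j=1$ in the sense just given, i.e. the identities hold with $j=1$. - $a$ is left generalized Drazin invertible if there is $x\in\mathcal{A}$ with $axa=xa^2$, $x^2a=x$, $axa-a\in\mathcal{A}^{qnil}$; it is right generalized Drazin invertible if there is $y\in\mathcal{A}$ with $aya=a^2y$, $ay^2=y$, $aya-a\in\mathcal{A}^{qnil}$. *)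

theory Defs
  imports Complex_Main "HOL-Library.Extended_Nonnegative_Real"
begin

text \<open>
  A nonzero complex unital Banach algebra, with the usual normalisation that the unit has norm 1
  (both inherited from \<^class>\<open>real_normed_algebra_1\<close>).  The complex scalar multiplication extends
  the real one that \<^class>\<open>real_normed_algebra_1\<close> provides.
\<close>

class complex_banach_algebra_1 = real_normed_algebra_1 + banach +
  fixes scaleC :: "complex \<Rightarrow> 'a \<Rightarrow> 'a" (infixr \<open>*\<^sub>C\<close> 75)
  assumes scaleC_add_right: "z *\<^sub>C (x + y) = z *\<^sub>C x + z *\<^sub>C y"
    and scaleC_add_left: "(z + w) *\<^sub>C x = z *\<^sub>C x + w *\<^sub>C x"
    and scaleC_scaleC: "z *\<^sub>C w *\<^sub>C x = (z * w) *\<^sub>C x"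
    and scaleC_one: "1 *\<^sub>C x = x"
    and scaleR_scaleC: "r *\<^sub>R x = complex_of_real r *\<^sub>C x"
    and mult_scaleC_left: "(z *\<^sub>C x) * y = z *\<^sub>C (x * y)"
    and mult_scaleC_right: "x * (z *\<^sub>C y) = z *\<^sub>C (x * y)"
    and norm_scaleC: "norm (z *\<^sub>C x) = cmod z * norm x"

instantiation complex :: complex_banach_algebra_1
begin

definition scaleC_complex :: "complex \<Rightarrow> complex \<Rightarrow> complex"
  where "scaleC_complex z w = z * w"

instance
  by standard (simp_all add: scaleC_complex_def algebra_simps norm_mult scaleR_conv_of_real)

end

definition spectrum :: "'a::complex_banach_algebra_1 \<Rightarrow> complex set"
  where "spectrum a = {z. \<not> (\<exists>b. b * (z *\<^sub>C 1 - a) = 1 \<and> (z *\<^sub>C 1 - a) * b = 1)}"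

text \<open>
  The supremum is taken in \<^typ>\<open>ennreal\<close>, so that it is meaningful without first proving that the
  spectrum is nonempty and bounded.
\<close>

definition spectral_radius :: "'a::complex_banach_algebra_1 \<Rightarrow> ennreal"
  where "spectral_radius a = (SUP z\<in>spectrum a. ennreal (cmod z))"

definition qnil :: "'a::complex_banach_algebra_1 set"
  where "qnil = {a. spectral_radius a = 0}"

text \<open>
  Having index \<open>j\<close> only means that the identities hold for this \<open>j\<close>; minimality of \<open>j\<close> is not
  required.
\<close>

definition left_drazin_invertible :: "'a::complex_banach_algebra_1 \<Rightarrow> nat \<Rightarrow> bool"
  where "left_drazin_invertible a j \<longleftrightarrow>
    (\<exists>x. a * x * a = x * a ^ 2 \<and> x ^ 2 * a = x \<and> x * a ^ (j + 1) = a ^ j)"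

definition right_drazin_invertible :: "'a::complex_banach_algebra_1 \<Rightarrow> nat \<Rightarrow> bool"
  where "right_drazin_invertible a j \<longleftrightarrow>
    (\<exists>y. a * y * a = a ^ 2 * y \<and> a * y ^ 2 = y \<and> a ^ (j + 1) * y = a ^ j)"

definition left_group_invertible :: "'a::complex_banach_algebra_1 \<Rightarrow> bool"
  where "left_group_invertible a \<longleftrightarrow> left_drazin_invertible a 1"

definition right_group_invertible :: "'a::complex_banach_algebra_1 \<Rightarrow> bool"
  where "right_group_invertible a \<longleftrightarrow> right_drazin_invertible a 1"

definition left_gen_drazin_invertible :: "'a::complex_banach_algebra_1 \<Rightarrow> bool"
  where "left_gen_drazin_invertible a \<longleftrightarrow>
    (\<exists>x. a * x * a = x * a ^ 2 \<and> x ^ 2 * a = x \<and> a * x * a - a \<in> qnil)"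

definition right_gen_drazin_invertible :: "'a::complex_banach_algebra_1 \<Rightarrow> bool"
  where "right_gen_drazin_invertible a \<longleftrightarrow>
    (\<exists>y. a * y * a = a ^ 2 * y \<and> a * y ^ 2 = y \<and> a * y * a - a \<in> qnil)"

end

theory Submission
  imports Defs
begin

text \<open>
  The left identities make \<open>e = x * a\<close> an idempotent commuting with \<open>a\<close>; writing
  \<open>p = 1 - e\<close>, left (generalized) Drazin invertibility of \<open>a\<close> therefore means that some idempotent
  \<open>p\<close> commuting with \<open>a\<close> splits \<open>a\<close> into a part \<open>a * (1 - p)\<close> that is left invertible in the corner
  of \<open>1 - p\<close> (equivalently, \<open>1 - p\<close> is a left multiple of \<open>a\<close>) and a small part \<open>a * p\<close>, in the
  sense that \<open>a ^ j * p = 0\<close> (that \<open>a * p\<close> is quasinilpotent).  The right versions differ only in that \<open>1 - p\<close> is a right multiple.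

  Now let \<open>p\<close> be such an idempotent for \<open>1 - a * c\<close>.  The small part \<open>(1 - a * c) * p\<close> does not have
  \<open>1\<close> in its spectrum, so \<open>a * c\<close> restricted to the corner of \<open>p\<close> is invertible there, with inverse
  \<open>u\<close> say, and \<open>q = c * u * a\<close> is an idempotent commuting with \<open>1 - c * a\<close>.  The intertwining
  \<open>(1 - c * a) * c = c * (1 - a * c)\<close> carries one-sided invertibility and nilpotency from \<open>p\<close> to
  \<open>q\<close>.  For quasinilpotency, \<open>(1 - c * a) * q\<close> and \<open>(1 - a * c) * p\<close> are products of the same two
  factors in opposite orders, so that they have the same nonzero spectrum by Jacobson's lemma.
  Exchanging \<open>a\<close> and \<open>c\<close> gives the converse implications.
\<close>

section \<open>Two-sided invertibility and Jacobson's lemma\<close>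

definition two_sided_invertible :: "'a::ring_1 \<Rightarrow> bool"
  where "two_sided_invertible a \<longleftrightarrow> (\<exists>b. b * a = 1 \<and> a * b = 1)"

lemma two_sided_invertibleI: "b * a = 1 \<Longrightarrow> a * b = 1 \<Longrightarrow> two_sided_invertible a"
  by (auto simp: two_sided_invertible_def)

text \<open>
  Expanding formally, \<open>(1 - y * x)\<^sup>-\<^sup>1 = 1 + y * x + y * x * y * x + \<dots> = 1 + y * (1 - x * y)\<^sup>-\<^sup>1 * x\<close>;
  the last expression is an inverse whether or not the series converges.
\<close>

lemma two_sided_invertible_one_minus_swap:
  fixes x y :: "'a::ring_1"
  assumes "two_sided_invertible (1 - x * y)"
  shows "two_sided_invertible (1 - y * x)"
proof -
  from assms obtain b where b: "b * (1 - x * y) = 1" "(1 - x * y) * b = 1"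
    by (auto simp: two_sided_invertible_def)
  have "(1 + y * b * x) * (1 - y * x) = 1 - y * x + y * (b * (1 - x * y)) * x"
    by (simp add: algebra_simps)
  moreover have "(1 - y * x) * (1 + y * b * x) = 1 - y * x + y * ((1 - x * y) * b) * x"
    by (simp add: algebra_simps)
  ultimately show ?thesis
    by (intro two_sided_invertibleI[of "1 + y * b * x"]) (simp_all add: b)
qed

lemma two_sided_invertible_one_minus_nilpotent:
  fixes d :: "'a::ring_1"
  assumes "d ^ n = 0"
  shows "two_sided_invertible (1 - d)"
proof (rule two_sided_invertibleI)
  have geom: "(1 - d) * (\<Sum>i<m. d ^ i) = 1 - d ^ m" for m
  proof (induction m)
    case (Suc m)
    have "(1 - d) * (\<Sum>i<Suc m. d ^ i) = (1 - d) * (\<Sum>i<m. d ^ i) + (1 - d) * d ^ m"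
      by (simp add: distrib_left)
    also have "\<dots> = 1 - d ^ m + (1 - d) * d ^ m"
      by (simp only: Suc.IH)
    finally show ?case
      by (simp add: left_diff_distrib)
  qed simp
  show "(1 - d) * (\<Sum>i<n. d ^ i) = 1"
    by (simp add: geom assms)
  have "(\<Sum>i<n. d ^ i) * (1 - d) = (1 - d) * (\<Sum>i<n. d ^ i)"
    by (simp add: left_diff_distrib right_diff_distrib sum_distrib_left sum_distrib_right
        power_commutes sum_subtractf)
  then show "(\<Sum>i<n. d ^ i) * (1 - d) = 1"
    by (simp add: geom assms)
qed

lemma inverse_commutes:
  fixes v w z :: "'a::ring_1"
  assumes "v * w = 1" "w * v = 1" "w * z = z * w"
  shows "v * z = z * v"
proof -
  have "v * z = v * (z * w) * v"
    using assms(2) by (simp add: mult.assoc)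
  also have "\<dots> = z * v"
    by (simp add: assms flip: assms(3) mult.assoc)
  finally show ?thesis .
qed

section \<open>Quasinilpotent elements\<close>

text \<open>
  Rescaling \<open>z - a\<close> to \<open>1 - z\<^sup>-\<^sup>1 * a\<close> removes the restriction to nonzero \<open>z\<close>, and brings the
  resolvent into the form to which Jacobson's lemma applies.
\<close>

lemma qnil_iff:
  fixes a :: "'a::complex_banach_algebra_1"
  shows "a \<in> qnil \<longleftrightarrow> (\<forall>z. two_sided_invertible (1 - z *\<^sub>C a))"
proof -
  have scaleC_zero: "0 *\<^sub>C x = 0" for x :: 'a
    using scaleC_add_left[of 0 0 x] by simp
  have scaleC_diff: "z *\<^sub>C (x - y) = z *\<^sub>C x - z *\<^sub>C y" for z and x y :: 'a
    using scaleC_add_right[of z "x - y" y] by (simp add: algebra_simps)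
  have scale: "two_sided_invertible (z *\<^sub>C x)"
    if x: "two_sided_invertible x" and z: "z \<noteq> 0" for z and x :: 'a
  proof -
    from x obtain b where "b * x = 1" "x * b = 1"
      by (auto simp: two_sided_invertible_def)
    then show ?thesis
      using z by (intro two_sided_invertibleI[of "inverse z *\<^sub>C b"])
        (simp_all add: mult_scaleC_left mult_scaleC_right scaleC_scaleC scaleC_one)
  qed
  have resolvent: "two_sided_invertible (z *\<^sub>C 1 - a) \<longleftrightarrow> two_sided_invertible (1 - inverse z *\<^sub>C a)"
    if z: "z \<noteq> 0" for z
  proof
    assume "two_sided_invertible (z *\<^sub>C 1 - a)"
    from scale[OF this, of "inverse z"] z show "two_sided_invertible (1 - inverse z *\<^sub>C a)"
      by (simp add: scaleC_diff scaleC_scaleC scaleC_one)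
  next
    assume "two_sided_invertible (1 - inverse z *\<^sub>C a)"
    from scale[OF this z] z show "two_sided_invertible (z *\<^sub>C 1 - a)"
      by (simp add: scaleC_diff scaleC_scaleC scaleC_one)
  qed
  have "a \<in> qnil \<longleftrightarrow> (\<forall>z\<in>spectrum a. z = 0)"
    by (simp add: qnil_def spectral_radius_def SUP_eq_iff bot_ennreal[symmetric] SUP_bot_conv)
      (simp add: bot_ennreal)
  also have "\<dots> \<longleftrightarrow> (\<forall>z. z \<noteq> 0 \<longrightarrow> two_sided_invertible (z *\<^sub>C 1 - a))"
    by (auto simp: spectrum_def two_sided_invertible_def)
  also have "\<dots> \<longleftrightarrow> (\<forall>z. z \<noteq> 0 \<longrightarrow> two_sided_invertible (1 - inverse z *\<^sub>C a))"
    using resolvent by blast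
  also have "\<dots> \<longleftrightarrow> (\<forall>z. two_sided_invertible (1 - z *\<^sub>C a))"
  proof (intro iffI allI impI)
    fix z
    assume *: "\<forall>z. z \<noteq> 0 \<longrightarrow> two_sided_invertible (1 - inverse z *\<^sub>C a)"
    show "two_sided_invertible (1 - z *\<^sub>C a)"
    proof (cases "z = 0")
      case True
      then show ?thesis
        by (intro two_sided_invertibleI[of 1]) (simp_all add: scaleC_zero)
    next
      case False
      then show ?thesis
        using *[rule_format, of "inverse z"] by simp
    qed
  qed blast
  finally show ?thesis .
qed

lemma qnil_uminus_iff:
  fixes a :: "'a::complex_banach_algebra_1"
  shows "- a \<in> qnil \<longleftrightarrow> a \<in> qnil"
proof -
  have minus: "- x \<in> qnil" if "x \<in> qnil" for x :: 'a
  proof -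
    have "z *\<^sub>C (- x) = (- z) *\<^sub>C x" for z
    proof -
      have "z *\<^sub>C 0 = (0 :: 'a)" "0 *\<^sub>C x = 0"
        using scaleC_add_right[of z 0 "0 :: 'a"] scaleC_add_left[of 0 0 x] by simp_all
      then have "z *\<^sub>C (- x) + z *\<^sub>C x = 0" "(- z) *\<^sub>C x + z *\<^sub>C x = 0"
        by (simp_all flip: scaleC_add_right scaleC_add_left)
      then show ?thesis
        by (metis add_right_cancel)
    qed
    with that show ?thesis
      by (simp add: qnil_iff)
  qed
  from minus[of a] minus[of "- a"] show ?thesis
    by auto
qed

lemma qnil_mult_swap:
  fixes x y :: "'a::complex_banach_algebra_1"
  assumes "x * y \<in> qnil"
  shows "y * x \<in> qnil"
  unfolding qnil_iff
proof
  fix z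
  from assms have "two_sided_invertible (1 - (z *\<^sub>C x) * y)"
    by (simp add: qnil_iff mult_scaleC_left)
  from two_sided_invertible_one_minus_swap[OF this]
  show "two_sided_invertible (1 - z *\<^sub>C (y * x))"
    by (simp add: mult_scaleC_right)
qed

lemma two_sided_invertible_one_minus_qnil:
  "d \<in> qnil \<Longrightarrow> two_sided_invertible (1 - d)"
  by (metis qnil_iff scaleC_one)

section \<open>Generalized inverses and commuting idempotents\<close>

text \<open>
  The remaining condition on the generalized inverse \<open>x\<close> only involves \<open>e = x * a\<close>, the idempotent
  complementary to \<open>p\<close>: it is left to an arbitrary predicate \<open>P\<close>, so that the Drazin and the
  generalized Drazin case are treated together.  Conversely, any \<open>x\<close> with \<open>x * a = 1 - p\<close> has to be
  cut down to \<open>x * (1 - p)\<close> to obtain \<open>x\<^sup>2 * a = x\<close>.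
\<close>

lemma left_inverse_iff_idempotent:
  fixes a :: "'a::ring_1"
  shows "(\<exists>x. a * x * a = x * a ^ 2 \<and> x ^ 2 * a = x \<and> P (x * a)) \<longleftrightarrow>
    (\<exists>p. p * p = p \<and> p * a = a * p \<and> (\<exists>x. x * a = 1 - p) \<and> P (1 - p))"
proof (intro iffI; elim exE conjE)
  fix x
  assume x: "a * x * a = x * a ^ 2" "x ^ 2 * a = x" "P (x * a)"
  have "x * a * (x * a) = x * (a * x * a)"
    by (simp add: mult.assoc)
  also have "\<dots> = x ^ 2 * a * a"
    unfolding x(1) by (simp add: power2_eq_square mult.assoc)
  finally have "x * a * (x * a) = x * a"
    by (simp only: x(2))
  moreover have "x * a * a = a * (x * a)"
    using x(1) by (simp add: power2_eq_square mult.assoc)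
  ultimately show "\<exists>p. p * p = p \<and> p * a = a * p \<and> (\<exists>x. x * a = 1 - p) \<and> P (1 - p)"
    using x(3) by (intro exI[of _ "1 - x * a"]) (auto simp: left_diff_distrib right_diff_distrib)
next
  fix p x
  assume p: "p * p = p" "p * a = a * p" "x * a = 1 - p" "P (1 - p)"
  define x' where "x' = x * (1 - p)"
  have ax: "x' * a = 1 - p"
  proof -
    have "x' * a = x * a * (1 - p)"
      by (simp add: x'_def mult.assoc left_diff_distrib right_diff_distrib p(2))
    also have "\<dots> = 1 - p"
      by (simp add: p left_diff_distrib right_diff_distrib)
    finally show ?thesis .
  qed
  have "a * x' * a = x' * a ^ 2"
    by (simp add: mult.assoc ax power2_eq_square)
      (simp add: left_diff_distrib right_diff_distrib p ax flip: mult.assoc)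
  moreover have "x' ^ 2 * a = x'"
    by (simp add: power2_eq_square mult.assoc ax)
      (simp add: x'_def mult.assoc left_diff_distrib right_diff_distrib p)
  ultimately show "\<exists>x. a * x * a = x * a ^ 2 \<and> x ^ 2 * a = x \<and> P (x * a)"
    using ax p(4) by metis
qed

lemma right_inverse_iff_idempotent:
  fixes a :: "'a::ring_1"
  shows "(\<exists>y. a * y * a = a ^ 2 * y \<and> a * y ^ 2 = y \<and> P (a * y)) \<longleftrightarrow>
    (\<exists>p. p * p = p \<and> p * a = a * p \<and> (\<exists>y. a * y = 1 - p) \<and> P (1 - p))"
proof (intro iffI; elim exE conjE)
  fix y
  assume y: "a * y * a = a ^ 2 * y" "a * y ^ 2 = y" "P (a * y)"
  have "a * y * (a * y) = a * y * a * y"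
    by (simp add: mult.assoc)
  also have "\<dots> = a * (a * y ^ 2)"
    unfolding y(1) by (simp add: power2_eq_square mult.assoc)
  finally have "a * y * (a * y) = a * y"
    by (simp only: y(2))
  moreover have "a * y * a = a * (a * y)"
    using y(1) by (simp add: power2_eq_square mult.assoc)
  ultimately show "\<exists>p. p * p = p \<and> p * a = a * p \<and> (\<exists>y. a * y = 1 - p) \<and> P (1 - p)"
    using y(3) by (intro exI[of _ "1 - a * y"]) (auto simp: left_diff_distrib right_diff_distrib)
next
  fix p y
  assume p: "p * p = p" "p * a = a * p" "a * y = 1 - p" "P (1 - p)"
  define y' where "y' = (1 - p) * y"
  have ay: "a * y' = 1 - p"
  proof -
    have "a * y' = (1 - p) * (a * y)"
      by (simp add: y'_def left_diff_distrib right_diff_distrib p(2) flip: mult.assoc)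
    also have "\<dots> = 1 - p"
      by (simp add: p left_diff_distrib right_diff_distrib)
    finally show ?thesis .
  qed
  have "a * y' * a = a ^ 2 * y'"
    by (simp add: ay power2_eq_square mult.assoc) (simp add: left_diff_distrib right_diff_distrib p)
  moreover have "a * y' ^ 2 = y'"
    by (simp add: power2_eq_square ay flip: mult.assoc)
      (simp add: y'_def left_diff_distrib right_diff_distrib p flip: mult.assoc)
  ultimately show "\<exists>y. a * y * a = a ^ 2 * y \<and> a * y ^ 2 = y \<and> P (a * y)"
    using ay p(4) by metis
qed

lemma left_drazin_invertible_iff:
  "left_drazin_invertible a j \<longleftrightarrow>
    (\<exists>p. p * p = p \<and> p * a = a * p \<and> (\<exists>x. x * a = 1 - p) \<and> a ^ j * p = 0)"
proof -
  have "left_drazin_invertible a j \<longleftrightarrow>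
      (\<exists>x. a * x * a = x * a ^ 2 \<and> x ^ 2 * a = x \<and> (x * a) * a ^ j = a ^ j)"
    by (simp add: left_drazin_invertible_def mult.assoc)
  also have "\<dots> \<longleftrightarrow>
      (\<exists>p. p * p = p \<and> p * a = a * p \<and> (\<exists>x. x * a = 1 - p) \<and> (1 - p) * a ^ j = a ^ j)"
    by (rule left_inverse_iff_idempotent)
  also have "\<dots> \<longleftrightarrow> (\<exists>p. p * p = p \<and> p * a = a * p \<and> (\<exists>x. x * a = 1 - p) \<and> a ^ j * p = 0)"
    by (auto simp: left_diff_distrib power_commuting_commutes[symmetric])
  finally show ?thesis .
qed

lemma right_drazin_invertible_iff:
  "right_drazin_invertible a j \<longleftrightarrow>
    (\<exists>p. p * p = p \<and> p * a = a * p \<and> (\<exists>y. a * y = 1 - p) \<and> a ^ j * p = 0)"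
proof -
  have "right_drazin_invertible a j \<longleftrightarrow>
      (\<exists>y. a * y * a = a ^ 2 * y \<and> a * y ^ 2 = y \<and> a ^ j * (a * y) = a ^ j)"
    by (simp add: right_drazin_invertible_def mult.assoc power_commutes flip: mult.assoc)
  also have "\<dots> \<longleftrightarrow>
      (\<exists>p. p * p = p \<and> p * a = a * p \<and> (\<exists>y. a * y = 1 - p) \<and> a ^ j * (1 - p) = a ^ j)"
    by (rule right_inverse_iff_idempotent)
  finally show ?thesis
    by (simp add: right_diff_distrib)
qed

lemma left_gen_drazin_invertible_iff:
  "left_gen_drazin_invertible a \<longleftrightarrow>
    (\<exists>p. p * p = p \<and> p * a = a * p \<and> (\<exists>x. x * a = 1 - p) \<and> a * p \<in> qnil)"
proof -
  have "left_gen_drazin_invertible a \<longleftrightarrow>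
      (\<exists>x. a * x * a = x * a ^ 2 \<and> x ^ 2 * a = x \<and> a * (x * a) - a \<in> qnil)"
    by (simp add: left_gen_drazin_invertible_def mult.assoc)
  also have "\<dots> \<longleftrightarrow>
      (\<exists>p. p * p = p \<and> p * a = a * p \<and> (\<exists>x. x * a = 1 - p) \<and> a * (1 - p) - a \<in> qnil)"
    by (rule left_inverse_iff_idempotent)
  finally show ?thesis
    by (simp add: right_diff_distrib qnil_uminus_iff)
qed

lemma right_gen_drazin_invertible_iff:
  "right_gen_drazin_invertible a \<longleftrightarrow>
    (\<exists>p. p * p = p \<and> p * a = a * p \<and> (\<exists>y. a * y = 1 - p) \<and> a * p \<in> qnil)"
proof -
  have "right_gen_drazin_invertible a \<longleftrightarrow>
      (\<exists>y. a * y * a = a ^ 2 * y \<and> a * y ^ 2 = y \<and> (a * y) * a - a \<in> qnil)"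
    by (simp add: right_gen_drazin_invertible_def)
  also have "\<dots> \<longleftrightarrow>
      (\<exists>p. p * p = p \<and> p * a = a * p \<and> (\<exists>y. a * y = 1 - p) \<and> (1 - p) * a - a \<in> qnil)"
    by (rule right_inverse_iff_idempotent)
  also have "\<dots> \<longleftrightarrow> (\<exists>p. p * p = p \<and> p * a = a * p \<and> (\<exists>y. a * y = 1 - p) \<and> a * p \<in> qnil)"
    by (auto simp: left_diff_distrib qnil_uminus_iff)
  finally show ?thesis .
qed

section \<open>Transfer of the idempotent\<close>

text \<open>
  Since \<open>p * (a * c) = p * (1 - (1 - a * c) * p)\<close>, the invertibility hypothesis provides an inverse
  \<open>u\<close> of \<open>a * c\<close> in the corner of \<open>p\<close>.  The idempotent \<open>q = c * u * a\<close> is the projection that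
  corresponds to \<open>p\<close> under the isomorphism between the corners given by \<open>a\<close> and \<open>c\<close>.  The element
  \<open>d\<close> exhibits the two small parts as \<open>d * c\<close> and \<open>c * d\<close>.
\<close>

lemma transfer_idempotent:
  fixes a c p :: "'a::ring_1"
  assumes idem: "p * p = p"
    and comm: "p * (1 - a * c) = (1 - a * c) * p"
    and inv: "two_sided_invertible (1 - (1 - a * c) * p)"
  obtains q where "q * q = q" "q * (1 - c * a) = (1 - c * a) * q"
    and "\<exists>x. x * (1 - a * c) = 1 - p \<Longrightarrow> \<exists>x. x * (1 - c * a) = 1 - q"
    and "\<exists>y. (1 - a * c) * y = 1 - p \<Longrightarrow> \<exists>y. (1 - c * a) * y = 1 - q"
    and "\<And>n. (1 - a * c) ^ n * p = 0 \<Longrightarrow> (1 - c * a) ^ n * q = 0"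
    and "\<exists>d. d * c = (1 - a * c) * p \<and> c * d = (1 - c * a) * q"
proof -
  define \<alpha> \<beta> where "\<alpha> = 1 - a * c" and "\<beta> = 1 - c * a"
  have ac: "a * c = 1 - \<alpha>" and ca: "c * a = 1 - \<beta>"
    by (simp_all add: \<alpha>_def \<beta>_def)
  have \<beta>c: "\<beta> * c = c * \<alpha>" and a\<beta>: "a * \<beta> = \<alpha> * a"
    by (simp_all add: \<alpha>_def \<beta>_def algebra_simps)
  have p\<alpha>: "p * \<alpha> = \<alpha> * p"
    using comm by (simp add: \<alpha>_def)
  from inv obtain v where v: "v * (1 - \<alpha> * p) = 1" "(1 - \<alpha> * p) * v = 1"
    by (auto simp: two_sided_invertible_def \<alpha>_def)
  have vp: "v * p = p * v"
    using v by (rule inverse_commutes)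
      (simp add: left_diff_distrib right_diff_distrib mult.assoc idem p\<alpha>,
       simp add: idem p\<alpha> flip: mult.assoc, simp add: idem mult.assoc)
  have v\<alpha>: "v * \<alpha> = \<alpha> * v"
    using v by (rule inverse_commutes)
      (simp add: left_diff_distrib right_diff_distrib mult.assoc p\<alpha>)
  define u where "u = v * p"
  have up: "u * p = u" and pu: "p * u = u"
    unfolding u_def by (simp add: mult.assoc idem, simp add: vp idem flip: mult.assoc)
  have u\<alpha>: "u * \<alpha> = \<alpha> * u"
    unfolding u_def by (simp add: mult.assoc p\<alpha>) (simp add: v\<alpha> flip: mult.assoc)
  have u_inv: "u * (1 - \<alpha>) = p"
  proof -
    have "u * (1 - \<alpha>) = v * (1 - \<alpha> * p) * p"
      by (simp add: u_def mult.assoc left_diff_distrib right_diff_distrib idem p\<alpha>)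
    with v show ?thesis
      by simp
  qed
  define q where "q = c * u * a"
  have "q * q = c * (u * (a * c) * u) * a"
    by (simp add: q_def mult.assoc)
  then have qq: "q * q = q"
    by (simp only: ac u_inv pu) (simp add: q_def mult.assoc)
  have \<beta>q: "\<beta> * q = c * (\<alpha> * u) * a"
    by (simp add: q_def \<beta>c flip: mult.assoc)
  have q\<beta>: "q * \<beta> = \<beta> * q"
    unfolding \<beta>q by (simp add: q_def mult.assoc a\<beta>) (simp add: u\<alpha> flip: mult.assoc)
  \<comment> \<open>The identity \<open>u = p + u * \<alpha>\<close>, conjugated by \<open>c\<close> and \<open>a\<close>, shows that \<open>q\<close> agrees with
    \<open>c * p * a\<close> up to a multiple of \<open>\<beta>\<close>.\<close>
  have q_eq: "q = c * p * a + q * \<beta>"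
  proof -
    have "u = p + u * \<alpha>"
      using u_inv by (simp add: right_diff_distrib algebra_simps)
    then have "q = c * (p + u * \<alpha>) * a"
      by (simp only: q_def)
    also have "\<dots> = c * p * a + c * u * a * \<beta>"
      by (simp add: distrib_left distrib_right mult.assoc a\<beta>)
    finally show ?thesis
      by (simp only: q_def)
  qed
  have one_minus_q: "1 - q = \<beta> + c * (1 - p) * a - q * \<beta>"
  proof -
    have "c * (1 - p) * a = c * a - c * p * a"
      by (simp add: left_diff_distrib right_diff_distrib)
    with q_eq show ?thesis
      by (simp add: ca algebra_simps)
  qed
  have left: "\<exists>x. x * \<beta> = 1 - q" if "\<exists>x. x * \<alpha> = 1 - p"
  proof -
    from that obtain x where x: "x * \<alpha> = 1 - p"
      by blast
    have "(1 + c * x * a - q) * \<beta> = 1 - q"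
      unfolding one_minus_q x[symmetric]
      by (simp add: distrib_right left_diff_distrib mult.assoc a\<beta>)
    then show ?thesis
      by blast
  qed
  have right: "\<exists>y. \<beta> * y = 1 - q" if "\<exists>y. \<alpha> * y = 1 - p"
  proof -
    from that obtain y where y: "\<alpha> * y = 1 - p"
      by blast
    have "\<beta> * (1 + c * y * a - q) = 1 - q"
      unfolding one_minus_q y[symmetric] q\<beta>
      by (simp add: distrib_left right_diff_distrib \<beta>c flip: mult.assoc)
    then show ?thesis
      by blast
  qed
  have nilpotent: "\<beta> ^ n * q = 0" if "\<alpha> ^ n * p = 0" for n
  proof -
    have "\<beta> ^ n * c = c * \<alpha> ^ n"
    proof (induction n)
      case (Suc n)
      have "\<beta> ^ Suc n * c = \<beta> * (\<beta> ^ n * c)"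
        by (simp add: mult.assoc)
      also have "\<dots> = \<beta> * c * \<alpha> ^ n"
        by (simp add: Suc.IH mult.assoc)
      finally show ?case
        by (simp add: \<beta>c mult.assoc)
    qed simp
    then have "\<beta> ^ n * q = c * (\<alpha> ^ n * (p * u)) * a"
      unfolding pu by (simp add: q_def flip: mult.assoc)
    also have "\<dots> = c * (\<alpha> ^ n * p * u) * a"
      by (simp add: mult.assoc)
    finally show ?thesis
      by (simp add: that)
  qed
  have "(\<alpha> * u * a) * c = \<alpha> * (u * (a * c))"
    by (simp add: mult.assoc)
  then have dc: "(\<alpha> * u * a) * c = \<alpha> * p"
    by (simp only: ac u_inv)
  have cd: "c * (\<alpha> * u * a) = \<beta> * q"
    unfolding \<beta>q by (simp add: mult.assoc)
  show ?thesis
    using that[of q] qq q\<beta> left right nilpotent dc cd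
    unfolding \<alpha>_def \<beta>_def by blast
qed

text \<open>
  Invertibility of \<open>1 - (1 - a * c) * p\<close> follows from \<open>((1 - a * c) * p) ^ Suc k = 0\<close>.  The exponent
  \<open>k\<close> would fail for \<open>k = 0\<close>: the hypothesis then says \<open>p = 0\<close>, while the power is \<open>1\<close>.
\<close>

lemma transfer_idempotent_nilpotent:
  fixes a c p :: "'a::ring_1"
  assumes idem: "p * p = p"
    and comm: "p * (1 - a * c) = (1 - a * c) * p"
    and nil: "(1 - a * c) ^ k * p = 0"
  obtains q where "q * q = q" "q * (1 - c * a) = (1 - c * a) * q"
    and "\<exists>x. x * (1 - a * c) = 1 - p \<Longrightarrow> \<exists>x. x * (1 - c * a) = 1 - q"
    and "\<exists>y. (1 - a * c) * y = 1 - p \<Longrightarrow> \<exists>y. (1 - c * a) * y = 1 - q"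
    and "(1 - c * a) ^ k * q = 0"
proof -
  define \<alpha> where "\<alpha> = 1 - a * c"
  have p\<alpha>: "p * \<alpha> = \<alpha> * p"
    using comm by (simp add: \<alpha>_def)
  have "(\<alpha> * p) ^ Suc n = \<alpha> * (\<alpha> ^ n * p)" for n
  proof (induction n)
    case (Suc n)
    have "(\<alpha> * p) ^ Suc (Suc n) = \<alpha> * p * (\<alpha> * (\<alpha> ^ n * p))"
      by (simp only: power_Suc[of _ "Suc n"] Suc.IH)
    also have "\<dots> = \<alpha> * (p * \<alpha> ^ Suc n) * p"
      by (simp add: mult.assoc)
    also have "\<dots> = \<alpha> * (\<alpha> ^ Suc n * p) * p"
      by (simp only: power_commuting_commutes[OF p\<alpha>[symmetric], symmetric])
    finally show ?case
      by (simp add: mult.assoc idem)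
  qed simp
  then have "(\<alpha> * p) ^ Suc k = 0"
    using nil by (simp add: \<alpha>_def del: power_Suc)
  then have "two_sided_invertible (1 - (1 - a * c) * p)"
    unfolding \<alpha>_def by (rule two_sided_invertible_one_minus_nilpotent)
  from transfer_idempotent[OF idem comm this] that nil show ?thesis
    by metis
qed

lemma transfer_idempotent_qnil:
  fixes a c p :: "'a::complex_banach_algebra_1"
  assumes idem: "p * p = p"
    and comm: "p * (1 - a * c) = (1 - a * c) * p"
    and qnil: "(1 - a * c) * p \<in> qnil"
  obtains q where "q * q = q" "q * (1 - c * a) = (1 - c * a) * q"
    and "\<exists>x. x * (1 - a * c) = 1 - p \<Longrightarrow> \<exists>x. x * (1 - c * a) = 1 - q"
    and "\<exists>y. (1 - a * c) * y = 1 - p \<Longrightarrow> \<exists>y. (1 - c * a) * y = 1 - q"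
    and "(1 - c * a) * q \<in> qnil"
  using transfer_idempotent[OF idem comm two_sided_invertible_one_minus_qnil[OF qnil]] that qnil
  by (metis qnil_mult_swap)

section \<open>Jacobson's lemma for one-sided Drazin inverses\<close>

lemma left_drazin_invertible_swap:
  assumes "left_drazin_invertible (1 - a * c) k"
  shows "left_drazin_invertible (1 - c * a) k"
  using assms unfolding left_drazin_invertible_iff by (metis transfer_idempotent_nilpotent)

lemma right_drazin_invertible_swap:
  assumes "right_drazin_invertible (1 - a * c) k"
  shows "right_drazin_invertible (1 - c * a) k"
  using assms unfolding right_drazin_invertible_iff by (metis transfer_idempotent_nilpotent)

lemma left_gen_drazin_invertible_swap:
  assumes "left_gen_drazin_invertible (1 - a * c)"
  shows "left_gen_drazin_invertible (1 - c * a)"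
  using assms unfolding left_gen_drazin_invertible_iff by (metis transfer_idempotent_qnil)

lemma right_gen_drazin_invertible_swap:
  assumes "right_gen_drazin_invertible (1 - a * c)"
  shows "right_gen_drazin_invertible (1 - c * a)"
  using assms unfolding right_gen_drazin_invertible_iff by (metis transfer_idempotent_qnil)

theorem corollary3p8:
  fixes a c :: "'a::complex_banach_algebra_1" and k :: nat
  shows "((left_drazin_invertible (1 - a * c) k \<longleftrightarrow> left_drazin_invertible (1 - c * a) k) \<and>
          (right_drazin_invertible (1 - a * c) k \<longleftrightarrow> right_drazin_invertible (1 - c * a) k)) \<and>
         ((left_group_invertible (1 - a * c) \<longleftrightarrow> left_group_invertible (1 - c * a)) \<and>
          (right_group_invertible (1 - a * c) \<longleftrightarrow> right_group_invertible (1 - c * a))) \<and>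
         ((left_gen_drazin_invertible (1 - a * c) \<longleftrightarrow> left_gen_drazin_invertible (1 - c * a)) \<and>
          (right_gen_drazin_invertible (1 - a * c) \<longleftrightarrow> right_gen_drazin_invertible (1 - c * a)))"
  unfolding left_group_invertible_def right_group_invertible_def
  using left_drazin_invertible_swap right_drazin_invertible_swap
    left_gen_drazin_invertible_swap right_gen_drazin_invertible_swap
  by blast

end
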